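(* Let $\mathcal{H}$ be a separable complex Hilbert space and let $E=(E_{n,k})_{n,k\ge 1}$ be an invertible infinite complex matrix mapping on $\bigoplus_{n=1}^{\infty}\mathcal{H}$ which satisfies $\sum_{n=1}^{\infty}\sum_{k=1}^{\infty}|E_{n,k}|^2<\infty$. Suppose that $\{f_k\}_{k=1}^{\infty}\in\bigoplus_{n=1}^{\infty}\mathcal{H}$ is an $E$-Bessel sequence. Let $T$ be the synthesis operator and $T^{*}$ the analysis operator of $\{f_k\}_{k=1}^\infty$, and let $T_E$ and $T_E^{*}$ be the pre-$E$-frame operator of $\{f_k\}_{k=1}^\infty$ and its adjoint. Then: (i) for each sequence $\{c_n\}_{n=1}^{\infty}\in\ell^2(\mathbb{N})$, $T_E\{c_n\}_{n=1}^{\infty}=T\left(E^t\{c_n\}_{n=1}^{\infty}\right)$; (ii) for each $f\in\mathcal{H}$, $T_E^{*}f=\overline{E}\,T^{*}f$.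
   Context: Inner products are linear in the first argument. $\bigoplus_{n=1}^{\infty}\mathcal{H}=\{\{f_n\}_{n=1}^\infty\subseteq\mathcal{H}:\sum_{n}\|f_n\|^2<\infty\}$. An infinite complex matrix $E=(E_{n,k})_{n,k\ge1}$ is invertible if there is an infinite complex matrix $E^{-1}$ with $EE^{-1}=E^{-1}E=I$ (all entrywise sums converging). For a sequence $\{f_k\}$ in $\mathcal{H}$ write $E\{f_k\}_{k=1}^\infty=\{\sum_{k=1}^\infty E_{n,k}f_k\}_{n=1}^\infty$, with $n$-th term $(E\{f_k\}_{k=1}^\infty)_n$. $E$ is a mapping on $\bigoplus_{n=1}^\infty\mathcal{H}$ if $E\{f_k\}$ is well defined and lies in $\bigoplus_{n=1}^\infty\mathcal{H}$ for every $\{f_k\}\in\bigoplus_{n=1}^\infty\mathcal{H}$. A sequence $\{f_k\}$ in $\mathcal{H}$ is Bessel if there is $B>0$ with $\sum_k|\langle f,f_k\rangle|^2\le B\|f\|^2$ for all $f\in\mathcal{H}$ (this holds for every $\{f_k\}\in\bigoplus_n\mathcal{H}$). It is $E$-Bessel if every series $\sum_{k}E_{n,k}f_k$ converges in $\mathcal{H}$ and there is $B>0$ with $\sum_n|\langle f,(E\{f_k\}_{k=1}^\infty)_n\rangle|^2\le B\|f\|^2$ for all $f\in\mathcal{H}$. For a Bessel sequence, $T:\ell^2(\mathbb{N})\to\mathcal{H}$, $T\{c_k\}=\sum_k c_kf_k$, and $T^{*}f=\{\langle f,f_k\rangle\}_{k=1}^\infty$. For an $E$-Bessel sequence, $T_E:\ell^2(\mathbb{N})\to\mathcal{H}$,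 $T_E\{c_n\}=\sum_n c_n(E\{f_k\}_{k=1}^\infty)_n$, and $T_E^{*}f=\{\langle f,(E\{f_k\}_{k=1}^\infty)_n\rangle\}_{n=1}^\infty$. $E^t$ and $\overline{E}$ act on $\ell^2(\mathbb{N})$ by $E^t\{c_k\}=\{\sum_{k}E_{k,n}c_k\}_{n=1}^\infty$ and $\overline{E}\{c_k\}=\{\sum_k\overline{E_{n,k}}c_k\}_{n=1}^\infty$. *)

theory Defs
  imports "HOL-Analysis.Analysis"
begin

section \<open>Complex Hilbert spaces\<close>

class complex_inner = real_normed_vector +
  fixes scaleC :: "complex \<Rightarrow> 'a \<Rightarrow> 'a"  (infixr \<open>*\<^sub>C\<close> 75)
    and cinner :: "'a \<Rightarrow> 'a \<Rightarrow> complex"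
  assumes scaleC_add_right: "a *\<^sub>C (x + y) = a *\<^sub>C x + a *\<^sub>C y"
    and scaleC_add_left: "(a + b) *\<^sub>C x = a *\<^sub>C x + b *\<^sub>C x"
    and scaleC_scaleC: "a *\<^sub>C b *\<^sub>C x = (a * b) *\<^sub>C x"
    and scaleC_one: "1 *\<^sub>C x = x"
    and scaleR_scaleC: "r *\<^sub>R x = complex_of_real r *\<^sub>C x"
    and cinner_commute: "cinner x y = cnj (cinner y x)"
    and cinner_add_left: "cinner (x + y) z = cinner x z + cinner y z"
    and cinner_scaleC_left: "cinner (a *\<^sub>C x) y = a * cinner x y"
    and cinner_ge_zero: "0 \<le> Re (cinner x x)"
    and cinner_eq_zero_iff: "cinner x x = 0 \<longleftrightarrow> x = 0"
    and norm_eq_sqrt_cinner: "norm x = sqrt (Re (cinner x x))"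

class chilbert_space = complex_inner + complete_space

instantiation complex :: chilbert_space
begin

definition scaleC_complex :: "complex \<Rightarrow> complex \<Rightarrow> complex"
  where "scaleC_complex a x = a * x"

definition cinner_complex :: "complex \<Rightarrow> complex \<Rightarrow> complex"
  where "cinner_complex x y = x * cnj y"

instance
  by standard
    (auto simp: scaleC_complex_def cinner_complex_def algebra_simps scaleR_conv_of_real
      complex_norm_square cmod_def power2_eq_square)

end


section \<open>Infinite matrices acting on sequences\<close>

text \<open>
  The index set \<open>{1, 2, \<dots>}\<close> is represented by the type \<^typ>\<open>nat\<close>, that is, all indices
  are shifted by one. Both \<open>\<ell>\<^sup>2(\<nat>)\<close> and the direct sum of countably many copies of a
  Hilbert space are instances of the following set, at type \<^typ>\<open>complex\<close> and at the
  type of the Hilbert space respectively.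
\<close>

definition square_summable :: "(nat \<Rightarrow> 'a::real_normed_vector) set"
  where "square_summable = {f. summable (\<lambda>n. (norm (f n))\<^sup>2)}"

type_synonym inf_matrix = "nat \<Rightarrow> nat \<Rightarrow> complex"

definition inf_mat_mult_is_id :: "inf_matrix \<Rightarrow> inf_matrix \<Rightarrow> bool"
  where "inf_mat_mult_is_id A B \<longleftrightarrow>
    (\<forall>n m. (\<lambda>k. A n k * B k m) sums (if n = m then 1 else 0))"

definition inf_mat_invertible :: "inf_matrix \<Rightarrow> bool"
  where "inf_mat_invertible E \<longleftrightarrow>
    (\<exists>F. inf_mat_mult_is_id E F \<and> inf_mat_mult_is_id F E)"

definition mat_transpose :: "inf_matrix \<Rightarrow> inf_matrix"
  where "mat_transpose E = (\<lambda>n k. E k n)"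

definition mat_cnj :: "inf_matrix \<Rightarrow> inf_matrix"
  where "mat_cnj E = (\<lambda>n k. cnj (E n k))"

text \<open>
  As \<^const>\<open>suminf\<close> is total, convergence of the defining series is a separate predicate.
\<close>

definition mat_act :: "inf_matrix \<Rightarrow> (nat \<Rightarrow> 'h::chilbert_space) \<Rightarrow> nat \<Rightarrow> 'h"
  where "mat_act E f = (\<lambda>n. \<Sum>k. E n k *\<^sub>C f k)"

definition mat_act_defined :: "inf_matrix \<Rightarrow> (nat \<Rightarrow> 'h::chilbert_space) \<Rightarrow> bool"
  where "mat_act_defined E f \<longleftrightarrow> (\<forall>n. summable (\<lambda>k. E n k *\<^sub>C f k))"

definition mat_maps_on :: "inf_matrix \<Rightarrow> (nat \<Rightarrow> 'h::chilbert_space) set \<Rightarrow> bool"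
  where "mat_maps_on E X \<longleftrightarrow> (\<forall>f\<in>X. mat_act_defined E f \<and> mat_act E f \<in> X)"


section \<open>Bessel sequences and their operators\<close>

definition bessel_seq :: "(nat \<Rightarrow> 'h::chilbert_space) \<Rightarrow> bool"
  where "bessel_seq f \<longleftrightarrow>
    (\<exists>B>0. \<forall>x. summable (\<lambda>k. (cmod (cinner x (f k)))\<^sup>2) \<and>
      (\<Sum>k. (cmod (cinner x (f k)))\<^sup>2) \<le> B * (norm x)\<^sup>2)"

definition E_bessel_seq :: "inf_matrix \<Rightarrow> (nat \<Rightarrow> 'h::chilbert_space) \<Rightarrow> bool"
  where "E_bessel_seq E f \<longleftrightarrow> mat_act_defined E f \<and> bessel_seq (mat_act E f)"

definition synthesis_op :: "(nat \<Rightarrow> 'h::chilbert_space) \<Rightarrow> (nat \<Rightarrow> complex) \<Rightarrow> 'h"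
  where "synthesis_op f c = (\<Sum>k. c k *\<^sub>C f k)"

definition analysis_op :: "(nat \<Rightarrow> 'h::chilbert_space) \<Rightarrow> 'h \<Rightarrow> nat \<Rightarrow> complex"
  where "analysis_op f x = (\<lambda>k. cinner x (f k))"

definition pre_E_frame_op ::
    "inf_matrix \<Rightarrow> (nat \<Rightarrow> 'h::chilbert_space) \<Rightarrow> (nat \<Rightarrow> complex) \<Rightarrow> 'h"
  where "pre_E_frame_op E f c = (\<Sum>n. c n *\<^sub>C mat_act E f n)"

definition pre_E_frame_adj ::
    "inf_matrix \<Rightarrow> (nat \<Rightarrow> 'h::chilbert_space) \<Rightarrow> 'h \<Rightarrow> nat \<Rightarrow> complex"
  where "pre_E_frame_adj E f x = (\<lambda>n. cinner x (mat_act E f n))"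


section \<open>Well-definedness of the operators\<close>

lemma cinner_zero_left [simp]: "cinner 0 (x::'a::complex_inner) = 0"
  using cinner_add_left [of 0 0 x] by simp

lemma cinner_sum_left:
  "cinner (\<Sum>k\<in>A. g k) (x::'a::complex_inner) = (\<Sum>k\<in>A. cinner (g k) x)"
  by (induction A rule: infinite_finite_induct) (simp_all add: cinner_add_left)

lemma cinner_self: "cinner x x = complex_of_real ((norm (x::'a::complex_inner))\<^sup>2)"
  using arg_cong[OF cinner_commute[of x x], of Im] cinner_ge_zero[of x]
  by (simp add: complex_eq_iff norm_eq_sqrt_cinner[of x])

lemma cmod_cinner_self: "cmod (cinner x x) = (norm (x::'a::complex_inner))\<^sup>2"
  unfolding cinner_self norm_of_real by simp

lemma cinner_add_right: "cinner (x::'a::complex_inner) (y + z) = cinner x y + cinner x z"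
  by (metis cinner_add_left cinner_commute complex_cnj_add)

lemma cinner_scaleC_right: "cinner (x::'a::complex_inner) (a *\<^sub>C y) = cnj a * cinner x y"
  by (metis cinner_scaleC_left cinner_commute complex_cnj_mult)

lemma cmod_cinner_le: "cmod (cinner x y) \<le> norm x * norm (y::'a::complex_inner)"
proof (cases "y = 0")
  case True
  then show ?thesis by (subst cinner_commute) simp
next
  case False
  define b where "b = cinner x y"
  define N where "N = (norm y)\<^sup>2"
  define a where "a = - (b / complex_of_real N)"
  have "N > 0" using False by (simp add: N_def)
  have yx: "cinner y x = cnj b" by (simp add: b_def cinner_commute[of y x])
  have "cinner (x + a *\<^sub>C y) (x + a *\<^sub>C y) =
      of_real ((norm x)\<^sup>2) + cnj a * b + a * cnj b + a * cnj a * of_real N"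
    by (simp add: cinner_add_left cinner_add_right cinner_scaleC_left cinner_scaleC_right
        cinner_self[of x] cinner_self[of y] yx b_def[symmetric] N_def algebra_simps)
  also have "\<dots> = of_real ((norm x)\<^sup>2) - b * cnj b / of_real N"
    using \<open>N > 0\<close> by (simp add: a_def field_simps)
  also have "\<dots> = of_real ((norm x)\<^sup>2 - (cmod b)\<^sup>2 / N)"
    by (simp add: complex_norm_square[symmetric])
  finally have "(norm x)\<^sup>2 - (cmod b)\<^sup>2 / N \<ge> 0"
    using cinner_ge_zero[of "x + a *\<^sub>C y"] by (metis Re_complex_of_real)
  then have "(cmod b)\<^sup>2 \<le> (norm x * norm y)\<^sup>2"
    using \<open>N > 0\<close> by (simp add: N_def field_simps power_mult_distrib)
  then show ?thesis
    unfolding b_def by (rule power2_le_imp_le) simp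
qed

lemma bounded_linear_cinner_left: "bounded_linear (\<lambda>x. cinner x (y::'a::complex_inner))"
  by (rule bounded_linear_intro[of _ "norm y"])
    (simp_all add: cinner_add_left scaleR_scaleC cinner_scaleC_left cmod_cinner_le
      scaleC_complex_def)

lemma square_summable_imp_bessel_seq:
  fixes f :: "nat \<Rightarrow> 'h::chilbert_space"
  assumes "f \<in> square_summable"
  shows "bessel_seq f"
proof -
  have f: "summable (\<lambda>k. (norm (f k))\<^sup>2)"
    using assms by (simp add: square_summable_def)
  define B where "B = (\<Sum>k. (norm (f k))\<^sup>2) + 1"
  have "B > 0"
    using suminf_nonneg[OF f] by (simp add: B_def)
  moreover have "summable (\<lambda>k. (cmod (cinner x (f k)))\<^sup>2) \<and>
      (\<Sum>k. (cmod (cinner x (f k)))\<^sup>2) \<le> B * (norm x)\<^sup>2" for x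
  proof -
    have le: "(cmod (cinner x (f k)))\<^sup>2 \<le> (norm x)\<^sup>2 * (norm (f k))\<^sup>2" for k
      using power_mono[OF cmod_cinner_le[of x "f k"], of 2] by (simp add: power_mult_distrib)
    have sm: "summable (\<lambda>k. (norm x)\<^sup>2 * (norm (f k))\<^sup>2)"
      by (rule summable_mult[OF f])
    have sc: "summable (\<lambda>k. (cmod (cinner x (f k)))\<^sup>2)"
      by (rule summable_comparison_test'[OF sm]) (simp add: le)
    have "(\<Sum>k. (cmod (cinner x (f k)))\<^sup>2) \<le> (\<Sum>k. (norm x)\<^sup>2 * (norm (f k))\<^sup>2)"
      by (rule suminf_le[OF le sc sm])
    also have "\<dots> = (norm x)\<^sup>2 * (\<Sum>k. (norm (f k))\<^sup>2)"
      by (rule suminf_mult[OF f])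
    also have "\<dots> \<le> B * (norm x)\<^sup>2"
      by (simp add: B_def algebra_simps)
    finally show ?thesis using sc by blast
  qed
  ultimately show ?thesis unfolding bessel_seq_def by blast
qed

lemma analysis_op_square_summable:
  "bessel_seq f \<Longrightarrow> analysis_op f x \<in> square_summable"
  by (auto simp: bessel_seq_def analysis_op_def square_summable_def)

lemma bessel_sum_bound:
  fixes f :: "nat \<Rightarrow> 'h::chilbert_space"
  assumes "finite A" "B > 0"
    and B: "\<And>x. summable (\<lambda>k. (cmod (cinner x (f k)))\<^sup>2) \<and>
      (\<Sum>k. (cmod (cinner x (f k)))\<^sup>2) \<le> B * (norm x)\<^sup>2"
  shows "norm (\<Sum>k\<in>A. c k *\<^sub>C f k) \<le> sqrt B * L2_set (\<lambda>k. cmod (c k)) A"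
proof -
  define s where "s = (\<Sum>k\<in>A. c k *\<^sub>C f k)"
  have "(\<Sum>k\<in>A. (cmod (cinner s (f k)))\<^sup>2) \<le> B * (norm s)\<^sup>2"
    using sum_le_suminf[of "\<lambda>k. (cmod (cinner s (f k)))\<^sup>2" A] B[of s] \<open>finite A\<close> by force
  then have "L2_set (\<lambda>k. cmod (cinner s (f k))) A \<le> sqrt (B * (norm s)\<^sup>2)"
    unfolding L2_set_def by (rule real_sqrt_le_mono)
  then have *: "L2_set (\<lambda>k. cmod (cinner s (f k))) A \<le> sqrt B * norm s"
    by (simp add: real_sqrt_mult)
  have "(norm s)\<^sup>2 = cmod (\<Sum>k\<in>A. c k * cinner (f k) s)"
    unfolding cmod_cinner_self[symmetric]
    by (subst (1) s_def) (simp add: cinner_sum_left cinner_scaleC_left)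
  also have "\<dots> \<le> (\<Sum>k\<in>A. \<bar>cmod (c k)\<bar> * \<bar>cmod (cinner s (f k))\<bar>)"
  proof (rule sum_norm_le)
    fix k
    show "cmod (c k * cinner (f k) s) \<le> \<bar>cmod (c k)\<bar> * \<bar>cmod (cinner s (f k))\<bar>"
      by (subst cinner_commute) (simp add: norm_mult)
  qed
  also have "\<dots> \<le> L2_set (\<lambda>k. cmod (c k)) A * L2_set (\<lambda>k. cmod (cinner s (f k))) A"
    by (rule L2_set_mult_ineq)
  also have "\<dots> \<le> L2_set (\<lambda>k. cmod (c k)) A * (sqrt B * norm s)"
    by (rule mult_left_mono[OF * L2_set_nonneg])
  finally have "norm s * norm s \<le> (sqrt B * L2_set (\<lambda>k. cmod (c k)) A) * norm s"
    by (simp add: power2_eq_square mult_ac)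
  moreover have "0 \<le> sqrt B * L2_set (\<lambda>k. cmod (c k)) A"
    using \<open>B > 0\<close> by (simp add: L2_set_nonneg)
  ultimately have "norm s \<le> sqrt B * L2_set (\<lambda>k. cmod (c k)) A"
    by (cases "norm s = 0") (auto dest: mult_right_le_imp_le)
  then show ?thesis by (simp add: s_def)
qed

lemma synthesis_op_summable:
  fixes f :: "nat \<Rightarrow> 'h::chilbert_space"
  assumes "bessel_seq f" "c \<in> square_summable"
  shows "summable (\<lambda>k. c k *\<^sub>C f k)"
proof -
  obtain B where "B > 0"
    and B: "\<And>x. summable (\<lambda>k. (cmod (cinner x (f k)))\<^sup>2) \<and>
      (\<Sum>k. (cmod (cinner x (f k)))\<^sup>2) \<le> B * (norm x)\<^sup>2"
    using assms(1) unfolding bessel_seq_def by blast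
  have "Cauchy (\<lambda>n. \<Sum>k<n. c k *\<^sub>C f k)"
  proof (rule CauchyI')
    fix e :: real assume "e > 0"
    then have "e\<^sup>2 / B > 0" using \<open>B > 0\<close> by simp
    then obtain N where N: "\<And>m n. m \<ge> N \<Longrightarrow> norm (\<Sum>k\<in>{m..<n}. (cmod (c k))\<^sup>2) < e\<^sup>2 / B"
      using assms(2) unfolding square_summable_def summable_Cauchy by blast
    have "norm ((\<Sum>k<m. c k *\<^sub>C f k) - (\<Sum>k<n. c k *\<^sub>C f k)) < e"
      if "m \<ge> N" "m < n" for m n
    proof -
      have "(\<Sum>k<n. c k *\<^sub>C f k) = (\<Sum>k<m. c k *\<^sub>C f k) + (\<Sum>k\<in>{m..<n}. c k *\<^sub>C f k)"
        using sum.atLeastLessThan_concat[of 0 m n "\<lambda>k. c k *\<^sub>C f k"] \<open>m < n\<close>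
        by (simp add: atLeast0LessThan)
      then have "norm ((\<Sum>k<m. c k *\<^sub>C f k) - (\<Sum>k<n. c k *\<^sub>C f k))
          = norm (\<Sum>k\<in>{m..<n}. c k *\<^sub>C f k)"
        by simp
      also have "\<dots> \<le> sqrt B * L2_set (\<lambda>k. cmod (c k)) {m..<n}"
        using bessel_sum_bound[OF _ \<open>B > 0\<close> B] by blast
      also have "\<dots> = sqrt (B * (\<Sum>k\<in>{m..<n}. (cmod (c k))\<^sup>2))"
        by (simp add: L2_set_def real_sqrt_mult)
      also have "\<dots> < sqrt (e\<^sup>2)"
        using N[OF \<open>m \<ge> N\<close>, of n] \<open>B > 0\<close>
        by (intro real_sqrt_less_mono) (simp add: sum_nonneg field_simps)
      finally show ?thesis using \<open>e > 0\<close> by simp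
    qed
    then show "\<exists>M. \<forall>m\<ge>M. \<forall>n>m. dist (\<Sum>k<m. c k *\<^sub>C f k) (\<Sum>k<n. c k *\<^sub>C f k) < e"
      by (auto simp: dist_norm)
  qed
  then show ?thesis
    by (simp add: summable_iff_convergent Cauchy_convergent_iff)
qed

lemma synthesis_op_adjoint:
  fixes f :: "nat \<Rightarrow> 'h::chilbert_space"
  assumes "bessel_seq f" "c \<in> square_summable"
  shows "(\<lambda>k. c k * cnj (analysis_op f x k)) sums cinner (synthesis_op f c) x"
proof -
  have "(\<lambda>k. c k *\<^sub>C f k) sums synthesis_op f c"
    unfolding synthesis_op_def by (rule summable_sums[OF synthesis_op_summable[OF assms]])
  from bounded_linear.sums[OF bounded_linear_cinner_left this]
  have "(\<lambda>k. c k * cinner (f k) x) sums cinner (synthesis_op f c) x"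
    by (simp add: cinner_scaleC_left)
  moreover have "cinner (f k) x = cnj (analysis_op f x k)" for k
    unfolding analysis_op_def by (rule cinner_commute)
  ultimately show ?thesis by simp
qed

lemma pre_E_frame_op_eq_synthesis_op: "pre_E_frame_op E f = synthesis_op (mat_act E f)"
  by (rule ext) (simp add: pre_E_frame_op_def synthesis_op_def)

lemma pre_E_frame_adj_eq_analysis_op: "pre_E_frame_adj E f = analysis_op (mat_act E f)"
  by (rule ext) (simp add: pre_E_frame_adj_def analysis_op_def)

end

theory Submission
  imports Defs
begin

text \<open>
  Part (ii) is continuity of the inner product: pulling \<open>\<langle>x, \<cdot>\<rangle>\<close> through the convergent series
  \<open>\<Sum>k. E n k *\<^sub>C f k\<close> conjugates the coefficients (lemma \<open>pre_E_frame_adj_sums\<close>).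

  Part (i) follows by duality. Testing \<open>T\<^sub>E c\<close> against a vector \<open>x\<close> gives
  \<open>\<Sum>n. c n * (\<Sum>k. E n k * d k)\<close>, where \<open>d k = \<langle>f k, x\<rangle>\<close>, whereas testing
  \<open>T (E\<^sup>t c)\<close> against \<open>x\<close> gives the same double series summed in the other order. As \<open>x\<close> is
  arbitrary, it remains to exchange the two summations for scalar sequences
  (lemma \<open>suminf_mult_mat_act_transpose\<close>). This is where the hypothesis \<open>\<Sum>n k. |E n k|\<^sup>2 < \<infinity>\<close>
  enters: the double sequences \<open>E n k\<close> and \<open>c n * d k\<close> are both square summable over all pairs, so
  their product is absolutely summable. The same hypothesis and the Cauchy--Schwarz inequality,
  applied to each row of the transposed matrix, show that \<open>E\<^sup>t c\<close> is again in \<open>\<ell>\<^sup>2\<close>, so that \<open>T\<close> may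
  be applied to it.
\<close>


section \<open>Square summable sequences and double series\<close>

lemma square_summable_iff_summable_on:
  "c \<in> square_summable \<longleftrightarrow> (\<lambda>n. (norm (c n))\<^sup>2) summable_on UNIV"
  by (simp add: square_summable_def summable_on_UNIV_nonneg_real_iff)

lemma summable_mult_square_summable:
  fixes a b :: "nat \<Rightarrow> complex"
  assumes "a \<in> square_summable" "b \<in> square_summable"
  shows "summable (\<lambda>k. norm (a k * b k))"
proof -
  have "(\<lambda>k. norm (a k * b k)) summable_on UNIV"
    by (rule abs_summable_product)
      (use assms in \<open>simp_all add: square_summable_iff_summable_on norm_mult power2_eq_square\<close>)
  then show ?thesis
    by (rule summable_on_imp_summable)
qed

lemma Cauchy_Schwarz_suminf:
  fixes a b :: "nat \<Rightarrow> complex"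
  assumes a: "a \<in> square_summable" and b: "b \<in> square_summable"
  shows "(cmod (\<Sum>k. a k * b k))\<^sup>2 \<le> (\<Sum>k. (cmod (a k))\<^sup>2) * (\<Sum>k. (cmod (b k))\<^sup>2)"
proof -
  have sa: "summable (\<lambda>k. (cmod (a k))\<^sup>2)" and sb: "summable (\<lambda>k. (cmod (b k))\<^sup>2)"
    using a b by (simp_all add: square_summable_def)
  have "(cmod (\<Sum>k<m. a k * b k))\<^sup>2 \<le> (\<Sum>k<m. (cmod (a k))\<^sup>2) * (\<Sum>k<m. (cmod (b k))\<^sup>2)" for m
  proof -
    have "cmod (\<Sum>k<m. a k * b k) \<le> (\<Sum>k<m. \<bar>cmod (a k)\<bar> * \<bar>cmod (b k)\<bar>)"
      by (rule sum_norm_le) (simp add: norm_mult)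
    also have "\<dots> \<le> L2_set (\<lambda>k. cmod (a k)) {..<m} * L2_set (\<lambda>k. cmod (b k)) {..<m}"
      by (rule L2_set_mult_ineq)
    finally have "(cmod (\<Sum>k<m. a k * b k))\<^sup>2
        \<le> (L2_set (\<lambda>k. cmod (a k)) {..<m} * L2_set (\<lambda>k. cmod (b k)) {..<m})\<^sup>2"
      by (rule power_mono) simp
    then show ?thesis
      by (simp add: power_mult_distrib L2_set_def sum_nonneg)
  qed
  moreover have "(\<lambda>m. (cmod (\<Sum>k<m. a k * b k))\<^sup>2) \<longlonglongrightarrow> (cmod (\<Sum>k. a k * b k))\<^sup>2"
    by (intro tendsto_intros summable_LIMSEQ summable_norm_cancel[OF
          summable_mult_square_summable[OF a b]])
  moreover have "(\<lambda>m. (\<Sum>k<m. (cmod (a k))\<^sup>2) * (\<Sum>k<m. (cmod (b k))\<^sup>2))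
      \<longlonglongrightarrow> (\<Sum>k. (cmod (a k))\<^sup>2) * (\<Sum>k. (cmod (b k))\<^sup>2)"
    by (intro tendsto_mult summable_LIMSEQ sa sb)
  ultimately show ?thesis
    by (intro LIMSEQ_le) auto
qed

lemma infsum_UNIV_eq_suminf:
  fixes g :: "nat \<Rightarrow> 'a::banach"
  assumes "g summable_on UNIV"
  shows "infsum g UNIV = suminf g"
  using has_sum_imp_sums[OF has_sum_infsum[OF assms]] by (rule sums_unique)

lemma suminf_swap:
  fixes g :: "nat \<Rightarrow> nat \<Rightarrow> complex"
  assumes g: "(\<lambda>(n, k). g n k) summable_on UNIV \<times> UNIV"
  shows "(\<Sum>n. \<Sum>k. g n k) = (\<Sum>k. \<Sum>n. g n k)"
proof -
  \<comment> \<open>Over \<open>nat\<close>, unconditional sums agree with iterated series; apply this to \<open>g\<close> and to its flip.\<close>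
  have iter: "infsum (\<lambda>n. infsum (h n) UNIV) UNIV = (\<Sum>n. \<Sum>k. h n k)"
    if h: "(\<lambda>(n, k). h n k) summable_on UNIV \<times> UNIV" for h :: "nat \<Rightarrow> nat \<Rightarrow> complex"
    using infsum_UNIV_eq_suminf[OF summable_on_Sigma_banach[OF h]]
      infsum_UNIV_eq_suminf[OF summable_on_SigmaD1[OF h UNIV_I]]
    by simp
  have flip: "(\<lambda>(k, n). g n k) summable_on UNIV \<times> UNIV"
    using g summable_on_swap[of "\<lambda>(n, k). g n k" UNIV UNIV] by simp
  show ?thesis
    using infsum_swap_banach[OF g] unfolding iter[OF g] iter[OF flip] .
qed


section \<open>Hilbert--Schmidt matrices\<close>

text \<open>
  Summability over pairs, rather than an iterated series over rows, makes the condition visibly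
  symmetric under transposition.
\<close>

definition hilbert_schmidt :: "inf_matrix \<Rightarrow> bool"
  where "hilbert_schmidt E \<longleftrightarrow> (\<lambda>(n, k). (cmod (E n k))\<^sup>2) summable_on UNIV \<times> UNIV"

lemma hilbert_schmidtI:
  assumes "\<And>n. summable (\<lambda>k. (cmod (E n k))\<^sup>2)"
    and "summable (\<lambda>n. \<Sum>k. (cmod (E n k))\<^sup>2)"
  shows "hilbert_schmidt E"
  unfolding hilbert_schmidt_def
proof (rule summable_on_SigmaI)
  show "((\<lambda>k. case (n, k) of (n, k) \<Rightarrow> (cmod (E n k))\<^sup>2) has_sum (\<Sum>k. (cmod (E n k))\<^sup>2)) UNIV" for n
    using norm_summable_imp_has_sum[of "\<lambda>k. (cmod (E n k))\<^sup>2"] assms(1)[of n]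
    by (simp add: summable_sums)
  show "(\<lambda>n. \<Sum>k. (cmod (E n k))\<^sup>2) summable_on UNIV"
    using assms by (intro summable_nonneg_imp_summable_on suminf_nonneg) auto
qed auto

lemma hilbert_schmidt_transpose: "hilbert_schmidt E \<Longrightarrow> hilbert_schmidt (mat_transpose E)"
  using summable_on_swap[of "\<lambda>(n, k). (cmod (E n k))\<^sup>2" UNIV UNIV]
  by (simp add: hilbert_schmidt_def mat_transpose_def)

lemma hilbert_schmidt_row:
  assumes "hilbert_schmidt E"
  shows "E n \<in> square_summable"
  using summable_on_SigmaD1[OF assms[unfolded hilbert_schmidt_def] UNIV_I]
  by (simp add: square_summable_iff_summable_on)

lemma hilbert_schmidt_summable_rows:
  assumes "hilbert_schmidt E"
  shows "summable (\<lambda>n. \<Sum>k. (cmod (E n k))\<^sup>2)"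
proof -
  have "(\<lambda>n. infsum (\<lambda>k. (cmod (E n k))\<^sup>2) UNIV) summable_on UNIV"
    using summable_on_Sigma_banach[OF assms[unfolded hilbert_schmidt_def]] .
  moreover have "infsum (\<lambda>k. (cmod (E n k))\<^sup>2) UNIV = (\<Sum>k. (cmod (E n k))\<^sup>2)" for n
    using hilbert_schmidt_row[OF assms, of n]
    by (simp add: infsum_UNIV_eq_suminf square_summable_iff_summable_on)
  ultimately show ?thesis
    by (simp add: summable_on_imp_summable)
qed

lemma hilbert_schmidt_mat_act_defined:
  fixes c :: "nat \<Rightarrow> complex"
  assumes "hilbert_schmidt E" "c \<in> square_summable"
  shows "mat_act_defined E c"
  using summable_norm_cancel[OF
      summable_mult_square_summable[OF hilbert_schmidt_row[OF assms(1)] assms(2)]]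
  by (simp add: mat_act_defined_def scaleC_complex_def)

text \<open>
  Cauchy--Schwarz bounds each entry of the image by the norm of its row times the norm of \<open>c\<close>, and
  the squared row norms are summable.
\<close>

lemma hilbert_schmidt_mat_act_square_summable:
  fixes c :: "nat \<Rightarrow> complex"
  assumes E: "hilbert_schmidt E" and c: "c \<in> square_summable"
  shows "mat_act E c \<in> square_summable"
  unfolding square_summable_def mem_Collect_eq
proof (rule summable_comparison_test')
  show "summable (\<lambda>n. (\<Sum>k. (cmod (E n k))\<^sup>2) * (\<Sum>k. (cmod (c k))\<^sup>2))"
    by (rule summable_mult2[OF hilbert_schmidt_summable_rows[OF E]])
  show "norm ((norm (mat_act E c n))\<^sup>2) \<le> (\<Sum>k. (cmod (E n k))\<^sup>2) * (\<Sum>k. (cmod (c k))\<^sup>2)" for n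
    using Cauchy_Schwarz_suminf[OF hilbert_schmidt_row[OF E] c]
    by (simp add: mat_act_def scaleC_complex_def)
qed

text \<open>
  The triple product is absolutely summable over all pairs because it splits into the two square
  summable double sequences \<open>E n k\<close> and \<open>c n * d k\<close>.
\<close>

lemma hilbert_schmidt_bilinear_summable:
  fixes c d :: "nat \<Rightarrow> complex"
  assumes E: "hilbert_schmidt E" and c: "c \<in> square_summable" and d: "d \<in> square_summable"
  shows "(\<lambda>(n, k). c n * (E n k * d k)) summable_on UNIV \<times> UNIV"
proof -
  have cd: "hilbert_schmidt (\<lambda>n k. c n * d k)"
  proof (rule hilbert_schmidtI)
    have sq: "summable (\<lambda>n. (cmod (c n))\<^sup>2)" "summable (\<lambda>k. (cmod (d k))\<^sup>2)"
      using c d by (simp_all add: square_summable_def)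
    show "summable (\<lambda>k. (cmod (c n * d k))\<^sup>2)" for n
      using sq by (simp add: norm_mult power_mult_distrib summable_mult)
    show "summable (\<lambda>n. \<Sum>k. (cmod (c n * d k))\<^sup>2)"
      using sq by (simp add: norm_mult power_mult_distrib suminf_mult summable_mult2)
  qed
  have "(\<lambda>p. norm (E (fst p) (snd p) * (c (fst p) * d (snd p)))) summable_on UNIV \<times> UNIV"
    by (rule abs_summable_product[of "\<lambda>p. E (fst p) (snd p)" _ "\<lambda>p. c (fst p) * d (snd p)"])
      (use E cd in \<open>simp_all add: hilbert_schmidt_def case_prod_unfold norm_mult power2_eq_square\<close>)
  then show ?thesis
    by (simp add: summable_on_iff_abs_summable_on_complex case_prod_unfold mult_ac)
qed

lemma suminf_mult_mat_act_transpose: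
  fixes c d :: "nat \<Rightarrow> complex"
  assumes E: "hilbert_schmidt E" and c: "c \<in> square_summable" and d: "d \<in> square_summable"
  shows "(\<Sum>n. c n * mat_act E d n) = (\<Sum>k. mat_act (mat_transpose E) c k * d k)"
proof -
  have "summable (\<lambda>k. E n k * d k)" for n
    using hilbert_schmidt_mat_act_defined[OF E d]
    by (simp add: mat_act_defined_def scaleC_complex_def)
  then have rows: "c n * mat_act E d n = (\<Sum>k. c n * (E n k * d k))" for n
    by (simp add: mat_act_def scaleC_complex_def suminf_mult)
  have "summable (\<lambda>n. E n k * c n)" for k
    using hilbert_schmidt_mat_act_defined[OF hilbert_schmidt_transpose[OF E] c]
    by (simp add: mat_act_defined_def mat_transpose_def scaleC_complex_def)
  then have "mat_act (mat_transpose E) c k * d k = (\<Sum>n. E n k * c n * d k)" for k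
    by (simp add: mat_act_def mat_transpose_def scaleC_complex_def suminf_mult2)
  then have cols: "mat_act (mat_transpose E) c k * d k = (\<Sum>n. c n * (E n k * d k))" for k
    by (simp add: mult_ac)
  show ?thesis
    unfolding rows cols by (rule suminf_swap[OF hilbert_schmidt_bilinear_summable[OF E c d]])
qed


section \<open>Matrices acting on sequences of vectors\<close>

lemma cinner_left_ext:
  fixes a b :: "'a::complex_inner"
  assumes "\<And>x. cinner a x = cinner b x"
  shows "a = b"
proof -
  have "cinner (a - b) (a - b) = 0"
    using assms[of "a - b"] by (simp add: linear_diff[OF bounded_linear.linear[OF bounded_linear_cinner_left]])
  then show ?thesis
    by (simp add: cinner_eq_zero_iff)
qed

lemma cinner_mat_act_sums:
  assumes "mat_act_defined E f"
  shows "(\<lambda>k. E n k * cnj (analysis_op f x k)) sums cinner (mat_act E f n) x"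
proof -
  have "(\<lambda>k. E n k *\<^sub>C f k) sums mat_act E f n"
    using assms by (simp add: mat_act_defined_def mat_act_def summable_sums)
  from bounded_linear.sums[OF bounded_linear_cinner_left this]
  have "(\<lambda>k. E n k * cinner (f k) x) sums cinner (mat_act E f n) x"
    by (simp add: cinner_scaleC_left)
  moreover have "cinner (f k) x = cnj (analysis_op f x k)" for k
    unfolding analysis_op_def by (rule cinner_commute)
  ultimately show ?thesis by simp
qed

lemma pre_E_frame_adj_sums:
  assumes "mat_act_defined E f"
  shows "(\<lambda>k. mat_cnj E n k *\<^sub>C analysis_op f x k) sums pre_E_frame_adj E f x n"
proof -
  have "(\<lambda>k. cnj (E n k * cnj (analysis_op f x k))) sums cnj (cinner (mat_act E f n) x)"
    using cinner_mat_act_sums[OF assms] by (simp only: sums_cnj)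
  moreover have "cnj (cinner (mat_act E f n) x) = pre_E_frame_adj E f x n"
    unfolding pre_E_frame_adj_def by (rule cinner_commute[symmetric])
  ultimately show ?thesis
    by (simp add: mat_cnj_def scaleC_complex_def)
qed

text \<open>
  Pairing both sides with \<open>x\<close> reduces the identity to scalar series; no exchange of sums in the
  Hilbert space itself is needed. As the inner product is conjugate linear on the right, the test
  sequence is the conjugate \<open>d\<close> of the analysis sequence of \<open>x\<close>.
\<close>

lemma pre_E_frame_op_eq_synthesis_op_transpose:
  assumes E: "hilbert_schmidt E" and f: "bessel_seq f" and Ef: "E_bessel_seq E f"
    and c: "c \<in> square_summable"
  shows "pre_E_frame_op E f c = synthesis_op f (mat_act (mat_transpose E) c)"
proof (rule cinner_left_ext)
  fix x
  define d where "d = (\<lambda>k. cnj (analysis_op f x k))"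
  have d: "d \<in> square_summable"
    using analysis_op_square_summable[OF f, of x] by (simp add: d_def square_summable_def)
  have "cnj (analysis_op (mat_act E f) x n) = mat_act E d n" for n
  proof -
    have "mat_act E d n = cinner (mat_act E f n) x"
      using cinner_mat_act_sums[of E f n x] Ef
      by (simp add: E_bessel_seq_def mat_act_def d_def scaleC_complex_def sums_iff)
    also have "\<dots> = cnj (analysis_op (mat_act E f) x n)"
      unfolding analysis_op_def by (rule cinner_commute)
    finally show ?thesis by simp
  qed
  then have "cinner (pre_E_frame_op E f c) x = (\<Sum>n. c n * mat_act E d n)"
    using synthesis_op_adjoint[of "mat_act E f" c x] Ef c
    by (simp add: E_bessel_seq_def pre_E_frame_op_eq_synthesis_op sums_iff)
  also have "\<dots> = (\<Sum>k. mat_act (mat_transpose E) c k * d k)"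
    by (rule suminf_mult_mat_act_transpose[OF E c d])
  also have "\<dots> = cinner (synthesis_op f (mat_act (mat_transpose E) c)) x"
    using synthesis_op_adjoint[OF f hilbert_schmidt_mat_act_square_summable[OF
          hilbert_schmidt_transpose[OF E] c], of x]
    by (simp add: d_def sums_iff)
  finally show "cinner (pre_E_frame_op E f c) x
      = cinner (synthesis_op f (mat_act (mat_transpose E) c)) x" .
qed

theorem theorem2p1p5:
  fixes E :: inf_matrix
    and f :: "nat \<Rightarrow> 'h::chilbert_space"
  assumes separable: "separable_space (euclidean :: 'h topology)"
    and invertible: "inf_mat_invertible E"
    and maps_on: "mat_maps_on E (square_summable :: (nat \<Rightarrow> 'h) set)"
    and rows_summable: "\<And>n. summable (\<lambda>k. (cmod (E n k))\<^sup>2)"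
    and matrix_summable: "summable (\<lambda>n. \<Sum>k. (cmod (E n k))\<^sup>2)"
    and f_mem: "f \<in> square_summable"
    and E_bessel: "E_bessel_seq E f"
  shows "(\<forall>c \<in> square_summable.
            mat_act_defined (mat_transpose E) c \<and>
            mat_act (mat_transpose E) c \<in> square_summable \<and>
            pre_E_frame_op E f c = synthesis_op f (mat_act (mat_transpose E) c)) \<and>
         (\<forall>x. mat_act_defined (mat_cnj E) (analysis_op f x) \<and>
            pre_E_frame_adj E f x = mat_act (mat_cnj E) (analysis_op f x))"
proof (intro conjI ballI allI)
  have E: "hilbert_schmidt E"
    by (rule hilbert_schmidtI[OF rows_summable matrix_summable])
  note Et = hilbert_schmidt_transpose[OF E]
  fix c :: "nat \<Rightarrow> complex"
  assume c: "c \<in> square_summable"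
  show "mat_act_defined (mat_transpose E) c"
    by (rule hilbert_schmidt_mat_act_defined[OF Et c])
  show "mat_act (mat_transpose E) c \<in> square_summable"
    by (rule hilbert_schmidt_mat_act_square_summable[OF Et c])
  show "pre_E_frame_op E f c = synthesis_op f (mat_act (mat_transpose E) c)"
    by (rule pre_E_frame_op_eq_synthesis_op_transpose[OF E
          square_summable_imp_bessel_seq[OF f_mem] E_bessel c])
next
  fix x
  have sums: "(\<lambda>k. mat_cnj E n k *\<^sub>C analysis_op f x k) sums pre_E_frame_adj E f x n" for n
    using E_bessel by (intro pre_E_frame_adj_sums) (simp add: E_bessel_seq_def)
  show "mat_act_defined (mat_cnj E) (analysis_op f x)"
    using sums by (auto simp: mat_act_defined_def sums_iff)
  show "pre_E_frame_adj E f x = mat_act (mat_cnj E) (analysis_op f x)"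
    using sums by (auto simp: mat_act_def sums_iff)
qed

end
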